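(* Let $x_1,\dots,x_n\in\mathbb{R}^p$ be data points and let $L_1,\dots,L_K$ be linear subspaces of $\mathbb{R}^p$, all of the same dimension $d$, with $1\le d<p$. Suppose that for each $k$ exactly $m$ of the data points lie on $L_k$, with $m\ge d+1$, that no data point lies on more than one of the $L_k$, and that every $q$-tuple of data points with $q\le p$ is linearly independent unless it includes at least $d+1$ points from $L_k$ for some $k\in\{1,\dots,K\}$. Then the RANSAC algorithm for subspace clustering (described in the context) is exact, i.e. the $K$ subspaces it returns are $L_1,\dots,L_K$ (in some order), and its total number of iterations has the distribution of $I_1+\dots+I_K$, where the $I_j$'s are independent and $I_j$ has the geometric distribution (supported on the positive integers) with success probability $$(K-j+1)\binom{m}{d+1}\Big/\binom{n-(j-1)m}{d+1}.$$ This is stochastically bounded (from above) by the negative binomial distribution with parameters $(K,\theta_1)$, where $\theta_1:=\binom{m}{d+1}/\binom{n}{d+1}$. Thus the expected number of iterations is bounded by $K/\theta_1$, which is of order $O(n/m)^{d+1}$ when $d$ and $K$ are held fixed (that is, for fixed $d$ and $K$ there is a constant $C_{d,K}$ such that $K/\theta_1\le C_{d,K}\,(n/m)^{d+1}$ for all $n\ge m\ge d+1$).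
   Context: A $q$-tuple of data points is a selection of $q$ of the data points with distinct indices (order is irrelevant). Points are identified with vectors; linear (in)dependence of points means linear (in)dependence as vectors. RANSAC algorithm for subspace clustering. Input: data points $x_1,\dots,x_n\in\mathbb{R}^p$, the dimension $d$, and the number of subspaces $K$. For $k=1,\dots,K$ do the following. Repeat: select a $(d+1)$-tuple uniformly at random among all $(d+1)$-tuples of the current data points, independently of previous draws (so the tuples are drawn with replacement); stop as soon as the drawn tuple is linearly dependent. Return the linear subspace spanned by that last tuple, and remove from the data all the points lying on that subspace. The number of iterations is the total number of tuples drawn over all $k=1,\dots,K$. The geometric distribution with success probability $\theta$ assigns probability $(1-\theta)^{k-1}\theta$ to $k\ge1$. The negative binomial distribution with parameters $(K,\theta)$ is here the distribution of the sum of $K$ independent such geometric random variables with success probability $\theta$ (number of trials until the $K$-th success). A random variable $X$ is stochastically bounded by a distribution with a random variable $Y$ following it if $\mathbb{P}(X\ge t)\le\mathbb{P}(Y\ge t)$ for all real $t$. *)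

theory Defs
  imports "HOL-Analysis.Analysis" "HOL-Probability.Probability"
begin

text \<open>Data points are a family \<open>x\<close> indexed by natural numbers, and a \<open>q\<close>-tuple is a set of \<open>q\<close>
  indices. Independence is that of the family \<open>(x i)\<close>, \<open>i \<in> S\<close>: equal vectors at two different
  indices of \<open>S\<close> make the tuple linearly dependent.\<close>

definition lin_indep_tuple :: "(nat \<Rightarrow> 'v::real_vector) \<Rightarrow> nat set \<Rightarrow> bool" where
  "lin_indep_tuple x S \<longleftrightarrow> inj_on x S \<and> independent (x ` S)"

definition tuples :: "nat \<Rightarrow> nat set \<Rightarrow> nat set set" where
  "tuples q A = {S. S \<subseteq> A \<and> card S = q}"

text \<open>Programs live in \<open>spmf\<close>: mass missing from the result is the probability of never halting (or of
  having no tuple to draw). The loop returns the subspace found and the number of tuples drawn.\<close>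

partial_function (spmf) ransac_loop ::
  "(nat \<Rightarrow> 'v::real_vector) \<Rightarrow> nat \<Rightarrow> nat set \<Rightarrow> ('v set \<times> nat) spmf" where
  "ransac_loop x d A =
     bind_spmf (spmf_of_set (tuples (d + 1) A)) (\<lambda>S.
       if \<not> lin_indep_tuple x S then return_spmf (span (x ` S), 1)
       else map_spmf (\<lambda>(V, t). (V, t + 1)) (ransac_loop x d A))"

primrec ransac ::
  "(nat \<Rightarrow> 'v::real_vector) \<Rightarrow> nat \<Rightarrow> nat \<Rightarrow> nat set \<Rightarrow> ('v set list \<times> nat) spmf" where
  "ransac x d 0 A = return_spmf ([], 0)"
| "ransac x d (Suc k) A =
     bind_spmf (ransac_loop x d A) (\<lambda>(V, s).
     bind_spmf (ransac x d k {i\<in>A. x i \<notin> V}) (\<lambda>(Vs, t).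
       return_spmf (V # Vs, s + t)))"

text \<open>The library's \<open>geometric_pmf\<close> counts failures and so is supported on \<open>{0..}\<close>.\<close>

definition geometric1_pmf :: "real \<Rightarrow> nat pmf" where
  "geometric1_pmf \<theta> = map_pmf Suc (geometric_pmf \<theta>)"

lemma pmf_geometric1:
  assumes "0 < \<theta>" "\<theta> \<le> 1" "k \<ge> 1"
  shows "pmf (geometric1_pmf \<theta>) k = (1 - \<theta>) ^ (k - 1) * \<theta>"
proof -
  obtain j where "k = Suc j" using assms(3) by (cases k) auto
  then show ?thesis using assms
    by (simp add: geometric1_pmf_def pmf_map_inj')
qed

text \<open>Law of \<open>I\<^sub>1 + \<dots> + I\<^sub>K\<close> for independent \<open>I\<^sub>j\<close> with law \<open>P j\<close>.\<close>

definition indep_sum_pmf :: "nat \<Rightarrow> (nat \<Rightarrow> nat pmf) \<Rightarrow> nat pmf" where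
  "indep_sum_pmf K P = map_pmf (\<lambda>I. \<Sum>j=1..K. I j) (Pi_pmf {1..K} 0 P)"

text \<open>Unlike the library's \<open>neg_binomial_pmf\<close>, this counts all trials, not only the failures.\<close>

definition neg_binomial_trials_pmf :: "nat \<Rightarrow> real \<Rightarrow> nat pmf" where
  "neg_binomial_trials_pmf K \<theta> = indep_sum_pmf K (\<lambda>_. geometric1_pmf \<theta>)"

definition stochastically_bounded :: "nat pmf \<Rightarrow> nat pmf \<Rightarrow> bool" where
  "stochastically_bounded X Y \<longleftrightarrow>
     (\<forall>t::real. measure_pmf.prob X {k. real k \<ge> t} \<le> measure_pmf.prob Y {k. real k \<ge> t})"

definition success_prob :: "nat \<Rightarrow> nat \<Rightarrow> nat \<Rightarrow> nat \<Rightarrow> nat \<Rightarrow> real" where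
  "success_prob K d n m j =
     real (K - j + 1) * real (m choose (d + 1)) / real ((n - (j - 1) * m) choose (d + 1))"

definition theta1 :: "nat \<Rightarrow> nat \<Rightarrow> nat \<Rightarrow> real" where
  "theta1 d n m = real (m choose (d + 1)) / real (n choose (d + 1))"

end

theory Submission
  imports Defs
begin

text \<open>By general position a drawn \<open>(d + 1)\<close>-tuple is linearly dependent exactly when it lies in one of
  the remaining subspaces, and then it spans that subspace, since any \<open>d\<close> of its points are
  independent. With \<open>K - j + 1\<close> subspaces and \<open>n - (j - 1) m\<close> points left, dependent tuples have
  frequency \<open>success_prob K d n m j\<close>, so the \<open>j\<close>-th loop is geometric whichever subspaces were found
  before; this makes the loop lengths independent. The rest is comparison of the success
  probabilities with \<open>theta1\<close>.\<close>

section \<open>Sums of independent random variables over a finite index set\<close>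

text \<open>Arbitrary index sets replace \<open>{1..K}\<close> so that induction by insertion
  applies and indices can be shifted.\<close>

definition sum_pmf :: "'a set \<Rightarrow> ('a \<Rightarrow> nat pmf) \<Rightarrow> nat pmf" where
  "sum_pmf S P = map_pmf (\<lambda>I. \<Sum>j\<in>S. I j) (Pi_pmf S 0 P)"

lemma sum_pmf_empty [simp]: "sum_pmf {} P = return_pmf 0"
  by (simp add: sum_pmf_def)

text \<open>Convolution form of the product measure: the new coordinate is drawn first and then
  added to an independent sum. The inductions below use only this recursion.\<close>

lemma sum_pmf_insert:
  assumes "finite S" "a \<notin> S"
  shows "sum_pmf (insert a S) P = bind_pmf (P a) (\<lambda>s. map_pmf ((+) s) (sum_pmf S P))"
proof -
  have "sum_pmf (insert a S) P =
      bind_pmf (P a) (\<lambda>s. map_pmf (\<lambda>I. \<Sum>j\<in>insert a S. (I(a := s)) j) (Pi_pmf S 0 P))"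
    using assms unfolding sum_pmf_def
    by (simp add: Pi_pmf_insert' map_bind_pmf map_pmf_def bind_assoc_pmf bind_return_pmf)
  moreover have "(\<lambda>I. \<Sum>j\<in>insert a S. (I(a := s)) j) = (\<lambda>I. s + (\<Sum>j\<in>S. I j))" for s :: nat
    using assms by (auto simp: fun_eq_iff intro!: sum.cong)
  ultimately show ?thesis
    by (simp only: sum_pmf_def pmf.map_comp o_def)
qed

lemma sum_pmf_reindex:
  assumes "finite S" "inj_on h S"
  shows "sum_pmf (h ` S) P = sum_pmf S (\<lambda>j. P (h j))"
  using assms by (induction S) (auto simp: sum_pmf_insert)

lemma sum_pmf_cong:
  assumes "finite S" "\<And>j. j \<in> S \<Longrightarrow> P j = Q j"
  shows "sum_pmf S P = sum_pmf S Q"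
  using assms by (induction S) (auto simp: sum_pmf_insert)

lemma indep_sum_pmf_eq: "indep_sum_pmf K P = sum_pmf {1..K} P"
  by (simp add: indep_sum_pmf_def sum_pmf_def)

lemma indep_sum_pmf_0: "indep_sum_pmf 0 P = return_pmf 0"
  by (simp add: indep_sum_pmf_eq)

text \<open>The first summand is split off, not the last, to match \<open>ransac\<close>, whose
  recursion runs one loop and then a smaller instance with rounds renumbered from 1.\<close>

lemma indep_sum_pmf_Suc:
  "indep_sum_pmf (Suc K) P =
     bind_pmf (P 1) (\<lambda>s. map_pmf ((+) s) (indep_sum_pmf K (\<lambda>j. P (Suc j))))"
proof -
  have "{1..Suc K} = insert 1 (Suc ` {1..K})"
    by auto
  moreover have "1 \<notin> Suc ` {1..K}"
    by auto
  ultimately show ?thesis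
    unfolding indep_sum_pmf_eq
    by (simp only: sum_pmf_insert sum_pmf_reindex finite_imageI finite_atLeastAtMost inj_Suc
        simp_thms not_False_eq_True)
qed

lemma indep_sum_pmf_cong:
  assumes "\<And>j. j \<in> {1..K} \<Longrightarrow> P j = Q j"
  shows "indep_sum_pmf K P = indep_sum_pmf K Q"
  unfolding indep_sum_pmf_eq using assms by (intro sum_pmf_cong) auto

text \<open>Linearity of expectation, once each coordinate of the product measure is recognised as
  having marginal \<open>P j\<close>.\<close>

lemma sum_pmf_expectation:
  assumes S: "finite S" and P: "\<And>j. j \<in> S \<Longrightarrow> integrable (measure_pmf (P j)) real"
  shows "integrable (measure_pmf (sum_pmf S P)) real"
    and "measure_pmf.expectation (sum_pmf S P) real = (\<Sum>j\<in>S. measure_pmf.expectation (P j) real)"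
proof -
  have *: "map_pmf (\<lambda>I. I j) (Pi_pmf S 0 P) = P j" if "j \<in> S" for j
    using S that by (simp add: Pi_pmf_component)
  have int: "integrable (measure_pmf (Pi_pmf S 0 P)) (\<lambda>I. real (I j))" if "j \<in> S" for j
    using P[OF that] unfolding *[OF that, symmetric] by simp
  have exp: "measure_pmf.expectation (P j) real =
      measure_pmf.expectation (Pi_pmf S 0 P) (\<lambda>I. real (I j))" if "j \<in> S" for j
    unfolding *[OF that, symmetric] by simp
  show "integrable (measure_pmf (sum_pmf S P)) real"
    unfolding sum_pmf_def using int by simp
  show "measure_pmf.expectation (sum_pmf S P) real = (\<Sum>j\<in>S. measure_pmf.expectation (P j) real)"
    unfolding sum_pmf_def using int exp by simp
qed

section \<open>Stochastic domination of sums\<close>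

lemma prob_bind_pmf:
  "measure_pmf.prob (bind_pmf p f) E = measure_pmf.expectation p (\<lambda>a. measure_pmf.prob (f a) E)"
  unfolding measure_pmf_bind
  by (rule measure_pmf.measure_bind[where N = "count_space UNIV"])
     (auto simp: space_subprob_algebra intro!: prob_space_imp_subprob_space prob_space_measure_pmf)

lemma prob_add_ge:
  "measure_pmf.prob (bind_pmf p (\<lambda>s. map_pmf ((+) s) q)) {k. real k \<ge> t} =
     measure_pmf.expectation p (\<lambda>s. measure_pmf.prob q {k. real k \<ge> t - real s})"
proof -
  have "((+) s) -` {k. real k \<ge> t} = {k. real k \<ge> t - real s}" for s
    by auto
  then show ?thesis
    by (simp add: prob_bind_pmf)
qed

text \<open>Conditioning on the value \<open>s\<close> of the common summand shifts the threshold to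
  \<open>t - real s\<close>; the tail bound holds for each \<open>s\<close> and is then averaged
  over \<open>p\<close>.\<close>

lemma stochastically_bounded_add_right:
  assumes "stochastically_bounded q q'"
  shows "stochastically_bounded (bind_pmf p (\<lambda>s. map_pmf ((+) s) q)) (bind_pmf p (\<lambda>s. map_pmf ((+) s) q'))"
  unfolding stochastically_bounded_def prob_add_ge
  using assms
  by (auto simp: stochastically_bounded_def
      intro!: integral_mono measure_pmf.integrable_const_bound[where B = 1])

lemma add_pmf_commute:
  fixes p q :: "nat pmf"
  shows "bind_pmf p (\<lambda>s. map_pmf ((+) s) q) = bind_pmf q (\<lambda>s. map_pmf ((+) s) p)"
  unfolding map_pmf_def by (subst bind_commute_pmf) (simp add: add.commute)

text \<open>The summands are exchanged one at a time: \<open>q\<close> for \<open>q'\<close> next to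
  \<open>p\<close>, then \<open>p\<close> for \<open>p'\<close> next to \<open>q'\<close>, with
  commutativity bringing the second exchange into the form of the first.\<close>

lemma stochastically_bounded_add:
  assumes "stochastically_bounded p p'" "stochastically_bounded q q'"
  shows "stochastically_bounded (bind_pmf p (\<lambda>s. map_pmf ((+) s) q)) (bind_pmf p' (\<lambda>s. map_pmf ((+) s) q'))"
  using stochastically_bounded_add_right[OF assms(2), of p]
    stochastically_bounded_add_right[OF assms(1), of q']
  unfolding add_pmf_commute[of q'] stochastically_bounded_def by (meson order_trans)

lemma stochastically_bounded_sum_pmf:
  assumes "finite S" "\<And>j. j \<in> S \<Longrightarrow> stochastically_bounded (P j) (Q j)"
  shows "stochastically_bounded (sum_pmf S P) (sum_pmf S Q)"
  using assms
proof (induction S)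
  case empty
  then show ?case by (simp add: stochastically_bounded_def)
next
  case (insert a S)
  then show ?case by (simp add: sum_pmf_insert stochastically_bounded_add)
qed

section \<open>Tails and mean of the geometric distribution\<close>

lemma pmf_geometric1_0: "pmf (geometric1_pmf \<theta>) 0 = 0"
  by (auto simp: geometric1_pmf_def pmf_eq_0_set_pmf)

lemma pmf_geometric1_Suc:
  assumes "0 < \<theta>" "\<theta> \<le> 1"
  shows "pmf (geometric1_pmf \<theta>) (Suc k) = (1 - \<theta>) ^ k * \<theta>"
  using pmf_geometric1[OF assms, of "Suc k"] by simp

lemma prob_geometric1_ge_Suc:
  assumes "0 < \<theta>" "\<theta> \<le> 1"
  shows "measure_pmf.prob (geometric1_pmf \<theta>) {Suc k..} = (1 - \<theta>) ^ k"
proof -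
  have "(\<Sum>i<Suc k. pmf (geometric1_pmf \<theta>) i) = 1 - (1 - \<theta>) ^ k"
    by (induction k) (use assms in \<open>simp_all add: pmf_geometric1_0 pmf_geometric1_Suc algebra_simps\<close>)
  then have "measure_pmf.prob (geometric1_pmf \<theta>) {..<Suc k} = 1 - (1 - \<theta>) ^ k"
    by (simp add: measure_measure_pmf_finite del: sum.lessThan_Suc)
  moreover have "{Suc k..} = UNIV - {..<Suc k}"
    by auto
  ultimately show ?thesis
    using measure_pmf.prob_compl[of "{..<Suc k}" "geometric1_pmf \<theta>"] by simp
qed

text \<open>The tail \<open>(1 - \<theta>) ^ k\<close> decreases as the success probability
  grows.\<close>

lemma stochastically_bounded_geometric1:
  assumes "0 < \<theta>" "\<theta> \<le> \<theta>'" "\<theta>' \<le> 1"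
  shows "stochastically_bounded (geometric1_pmf \<theta>') (geometric1_pmf \<theta>)"
  unfolding stochastically_bounded_def
proof
  fix t :: real
  \<comment> \<open>A real threshold becomes an integer one. For \<open>t \<le> 0\<close> it is 0,
    and both tails are the whole space.\<close>
  have eq: "{k. t \<le> real k} = {nat \<lceil>t\<rceil>..}"
    by (auto simp: nat_le_iff ceiling_le_iff)
  show "measure_pmf.prob (geometric1_pmf \<theta>') {k. t \<le> real k}
      \<le> measure_pmf.prob (geometric1_pmf \<theta>) {k. t \<le> real k}"
    unfolding eq
    by (cases "nat \<lceil>t\<rceil>")
      (use assms in \<open>auto simp: prob_geometric1_ge_Suc atLeast_0 intro!: power_mono\<close>)
qed

lemma geometric1_expectation:
  assumes "0 < \<theta>" "\<theta> \<le> 1"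
  shows "integrable (measure_pmf (geometric1_pmf \<theta>)) real"
    and "measure_pmf.expectation (geometric1_pmf \<theta>) real = 1 / \<theta>"
proof -
  have \<theta>: "\<theta> \<in> {0<..1}"
    using assms by simp
  note int = integrable_real_geometric_pmf[OF \<theta>]
  show "integrable (measure_pmf (geometric1_pmf \<theta>)) real"
    unfolding geometric1_pmf_def using int by simp
  have "measure_pmf.expectation (geometric1_pmf \<theta>) real = 1 + (1 - \<theta>) / \<theta>"
    unfolding geometric1_pmf_def using int expectation_geometric_pmf[OF \<theta>] by simp
  then show "measure_pmf.expectation (geometric1_pmf \<theta>) real = 1 / \<theta>"
    using assms by (simp add: field_simps)
qed

section \<open>The sampling loop\<close>

lemma finite_tuples: "finite A \<Longrightarrow> finite (tuples q A)"
  by (simp add: tuples_def)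

lemma card_tuples: "finite A \<Longrightarrow> card (tuples q A) = card A choose q"
  unfolding tuples_def by (rule n_subsets)

text \<open>Induction on the number of draws: a result with count \<open>Suc t\<close> comes from a
  dependent first tuple or from a recursive run with count \<open>t\<close>. Count 0 is impossible,
  since every run that halts draws at least once.\<close>

lemma ransac_loop_result:
  assumes "finite A" "(V, t) \<in> set_spmf (ransac_loop x d A)"
  shows "\<exists>S\<in>tuples (d + 1) A. \<not> lin_indep_tuple x S \<and> V = span (x ` S)"
  using assms(2)
proof (induction t)
  case 0
  then show ?case
    by (subst (asm) ransac_loop.simps)
      (auto simp: set_bind_spmf bind_UNION assms finite_tuples split: if_splits)
next
  case (Suc t)
  have "(V, Suc t) \<in> set_spmf (spmf_of_set (tuples (d + 1) A) \<bind> (\<lambda>S.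
      if \<not> lin_indep_tuple x S then return_spmf (span (x ` S), 1)
      else map_spmf (\<lambda>(V, t). (V, t + 1)) (ransac_loop x d A)))"
    using Suc.prems by (subst (asm) ransac_loop.simps)
  then show ?case
    using Suc.IH by (auto simp: set_bind_spmf bind_UNION assms finite_tuples split: if_splits)
qed

text \<open>Unfolding the loop once gives a recursion for the masses of the draw count, and this
  recursion determines them all. As the geometric masses add up to 1, almost sure termination
  follows from the equality itself.\<close>

lemma ransac_loop_iterations:
  fixes x :: "nat \<Rightarrow> 'v::real_vector"
  assumes A: "finite A"
    and D: "D = {S\<in>tuples (d + 1) A. \<not> lin_indep_tuple x S}" "D \<noteq> {}"
    and \<theta>: "\<theta> = real (card D) / real (card (tuples (d + 1) A))"
  shows "map_spmf snd (ransac_loop x d A) = spmf_of_pmf (geometric1_pmf \<theta>)"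
proof (rule spmf_eqI)
  fix k
  define T where "T = tuples (d + 1) A"
  define l where "l = map_spmf snd (ransac_loop x d A)"
  have T: "finite T" "D \<subseteq> T" "D = {S\<in>T. \<not> lin_indep_tuple x S}"
    using A D by (auto simp: T_def finite_tuples)
  then have card_pos: "0 < card D" "card D \<le> card T"
    using D(2) by (auto simp: card_gt_0_iff card_mono intro: finite_subset)
  have \<theta>T: "\<theta> = real (card D) / real (card T)"
    by (simp only: \<theta> T_def)
  then have \<theta>01: "0 < \<theta>" "\<theta> \<le> 1"
    using card_pos by auto
  have l: "l = bind_spmf (spmf_of_set T)
      (\<lambda>S. if S \<in> D then return_spmf 1 else map_spmf Suc l)"
    unfolding l_def
    by (subst ransac_loop.simps, unfold map_spmf_bind_spmf T_def[symmetric], rule bind_spmf_cong)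
      (auto simp: T spmf.map_comp o_def case_prod_beta)
  \<comment> \<open>The first draw is dependent with probability \<open>\<theta>\<close>, giving
    count 1; otherwise the same law restarts, shifted by one.\<close>
  have step: "spmf l j = \<theta> * indicat_real {1} j + (1 - \<theta>) * spmf (map_spmf Suc l) j" for j
  proof -
    have "spmf l j = (\<Sum>S\<in>T. if S \<in> D then indicat_real {1} j else spmf (map_spmf Suc l) j) / card T"
      by (subst l) (auto simp: spmf_bind integral_spmf_of_set indicator_def intro!: sum.cong
          arg_cong2[where f = "(/)"])
    also have "\<dots> = (card D * indicat_real {1} j + card (T - D) * spmf (map_spmf Suc l) j) / card T"
      using T(1,2) by (simp add: sum.If_cases Int_absorb1 Diff_eq)
    also have "\<dots> = \<theta> * indicat_real {1} j + (1 - \<theta>) * spmf (map_spmf Suc l) j"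
    proof -
      have "real (card T) \<noteq> 0"
        using card_pos by simp
      then show ?thesis
        using T(1,2) card_pos
        by (simp add: \<theta>T card_Diff_subset finite_subset of_nat_diff field_simps)
    qed
    finally show ?thesis .
  qed
  have 0: "spmf l 0 = 0"
    using step[of 0] by (simp add: spmf_map_outside image_iff)
  have Suc: "spmf l (Suc j) = (1 - \<theta>) ^ j * \<theta>" for j
  proof (induction j)
    case 0
    then show ?case
      using step[of 1] \<open>spmf l 0 = 0\<close> by (simp add: spmf_map_inj')
  next
    case (Suc j)
    then show ?case
      using step[of "Suc (Suc j)"] by (simp add: spmf_map_inj')
  qed
  show "spmf (map_spmf snd (ransac_loop x d A)) k = spmf (spmf_of_pmf (geometric1_pmf \<theta>)) k"
    unfolding l_def[symmetric]
    by (cases k) (use \<theta>01 in \<open>simp_all add: 0 Suc pmf_geometric1_0 pmf_geometric1_Suc\<close>)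
qed

section \<open>Clusters in general position\<close>

text \<open>The invariant of the algorithm: \<open>A\<close> holds the indices of the current points
  and \<open>R\<close> labels the subspaces not yet found. General position up to size
  \<open>d + 1\<close> covers the drawn tuples and their \<open>d\<close>-point subsets.\<close>

locale subspace_clusters =
  fixes x :: "nat \<Rightarrow> 'v::euclidean_space" and L :: "'k \<Rightarrow> 'v set" and d m :: nat
    and A :: "nat set" and R :: "'k set"
  assumes finite_A: "finite A" and finite_R: "finite R"
    and subspace: "k \<in> R \<Longrightarrow> subspace (L k)"
    and dim: "k \<in> R \<Longrightarrow> dim (L k) = d"
    and m: "d + 1 \<le> m"
    and card_cluster: "k \<in> R \<Longrightarrow> card {i\<in>A. x i \<in> L k} = m"
    and disjoint: "i \<in> A \<Longrightarrow> k \<in> R \<Longrightarrow> l \<in> R \<Longrightarrow> x i \<in> L k \<Longrightarrow> x i \<in> L l \<Longrightarrow> k = l"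
    and general_position: "S \<subseteq> A \<Longrightarrow> card S \<le> d + 1 \<Longrightarrow>
      (\<exists>k\<in>R. d + 1 \<le> card {i\<in>S. x i \<in> L k}) \<or> lin_indep_tuple x S"
begin

lemma dependent_tupleD:
  assumes "S \<in> tuples (d + 1) A" "\<not> lin_indep_tuple x S"
  obtains k where "k \<in> R" "S \<in> tuples (d + 1) {i\<in>A. x i \<in> L k}"
proof -
  from assms have S: "S \<subseteq> A" "card S = d + 1" "finite S"
    using finite_A by (auto simp: tuples_def intro: finite_subset)
  then obtain k where k: "k \<in> R" "d + 1 \<le> card {i\<in>S. x i \<in> L k}"
    using general_position[of S] assms by auto
  \<comment> \<open>\<open>S\<close> has only \<open>d + 1\<close> elements, so at least
    \<open>d + 1\<close> of them on \<open>L k\<close> means all of them.\<close>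
  then have "{i\<in>S. x i \<in> L k} = S"
    using S by (intro card_seteq) auto
  then show thesis
    using that[of k] k S by (auto simp: tuples_def)
qed

text \<open>Too many vectors for dimension \<open>d\<close> forces dependence. Conversely, any
  \<open>d\<close> of these points are independent and hence already span
  \<open>L k\<close>.\<close>

lemma tuple_in_subspace:
  assumes k: "k \<in> R" and S: "S \<in> tuples (d + 1) {i\<in>A. x i \<in> L k}"
  shows "\<not> lin_indep_tuple x S" and "span (x ` S) = L k"
proof -
  from S have S': "S \<subseteq> A" "card S = d + 1" "finite S" "x ` S \<subseteq> L k"
    using finite_A by (auto simp: tuples_def intro: finite_subset)
  show "\<not> lin_indep_tuple x S"
  proof
    assume "lin_indep_tuple x S"
    then have "independent (x ` S)" "card (x ` S) = d + 1"
      using S' by (auto simp: lin_indep_tuple_def card_image)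
    then show False
      using independent_card_le_dim[OF S'(4)] dim[OF k] by simp
  qed
  obtain T where T: "T \<subseteq> S" "card T = d"
    using S' by (metis obtain_subset_with_card_n le_add1)
  have fT: "finite T"
    using T S' finite_subset by blast
  \<comment> \<open>With only \<open>d\<close> points, \<open>T\<close> cannot meet the exceptional
    alternative of general position.\<close>
  have "card {i\<in>T. x i \<in> L l} \<le> d" for l
    using T fT by (metis (no_types, lifting) card_mono mem_Collect_eq subsetI)
  then have "lin_indep_tuple x T"
    using general_position[of T] T S' by (auto simp: not_less_eq_eq[symmetric])
  then have T': "independent (x ` T)" "card (x ` T) = d"
    using T by (auto simp: lin_indep_tuple_def card_image)
  have "L k \<subseteq> span (x ` T)"
    using T T' S' dim[OF k] by (intro card_ge_dim_independent) auto
  also have "\<dots> \<subseteq> span (x ` S)"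
    using T by (intro span_mono) auto
  finally show "span (x ` S) = L k"
    using span_minimal[OF S'(4) subspace[OF k]] by auto
qed

lemma dependent_tuples_eq:
  "{S\<in>tuples (d + 1) A. \<not> lin_indep_tuple x S} = (\<Union>k\<in>R. tuples (d + 1) {i\<in>A. x i \<in> L k})"
  using tuple_in_subspace(1) dependent_tupleD by (auto simp: tuples_def) blast+

text \<open>The dependent tuples split by cluster. The pieces are disjoint because a common tuple,
  being nonempty, would contain a point on two of the subspaces.\<close>

lemma card_dependent_tuples:
  "card {S\<in>tuples (d + 1) A. \<not> lin_indep_tuple x S} = card R * (m choose (d + 1))"
proof -
  have "tuples (d + 1) {i\<in>A. x i \<in> L k} \<inter> tuples (d + 1) {i\<in>A. x i \<in> L l} = {}"
    if "k \<in> R" "l \<in> R" "k \<noteq> l" for k l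
  proof (rule ccontr)
    assume "\<not> ?thesis"
    then obtain S where "S \<subseteq> {i\<in>A. x i \<in> L k}" "S \<subseteq> {i\<in>A. x i \<in> L l}" "card S = d + 1"
      by (auto simp: tuples_def)
    then show False
      using disjoint that by (cases "S = {}") fastforce+
  qed
  then have "card (\<Union>k\<in>R. tuples (d + 1) {i\<in>A. x i \<in> L k}) =
      (\<Sum>k\<in>R. card (tuples (d + 1) {i\<in>A. x i \<in> L k}))"
    using finite_R finite_A by (intro card_UN_disjoint) (auto simp: finite_tuples)
  also have "\<dots> = card R * (m choose (d + 1))"
    using finite_A by (simp add: card_tuples card_cluster)
  finally show ?thesis
    by (simp only: dependent_tuples_eq)
qed

lemma ransac_loop_in_range:
  assumes "(V, t) \<in> set_spmf (ransac_loop x d A)"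
  shows "\<exists>k\<in>R. V = L k"
  using ransac_loop_result[OF finite_A assms] dependent_tupleD tuple_in_subspace(2) by metis

text \<open>Stated for \<open>j = 1\<close> relative to the current \<open>R\<close> and
  \<open>A\<close>: every later round is the first round of a smaller instance.\<close>

lemma success_prob_first:
  assumes "R \<noteq> {}"
  shows "success_prob (card R) d (card A) m 1 > 0" "success_prob (card R) d (card A) m 1 \<le> 1"
    and "map_spmf snd (ransac_loop x d A) =
      spmf_of_pmf (geometric1_pmf (success_prob (card R) d (card A) m 1))"
proof -
  let ?D = "{S\<in>tuples (d + 1) A. \<not> lin_indep_tuple x S}"
  have R: "card R > 0"
    using assms finite_R by (simp add: card_gt_0_iff)
  have eq: "success_prob (card R) d (card A) m 1 = real (card ?D) / real (card (tuples (d + 1) A))"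
    using R unfolding success_prob_def card_dependent_tuples card_tuples[OF finite_A] by simp
  have D: "card ?D > 0"
    unfolding card_dependent_tuples using R m by (simp add: zero_less_binomial)
  moreover have "card ?D \<le> card (tuples (d + 1) A)"
    using finite_A by (intro card_mono) (auto simp: finite_tuples)
  ultimately show "success_prob (card R) d (card A) m 1 > 0" "success_prob (card R) d (card A) m 1 \<le> 1"
    unfolding eq by auto
  show "map_spmf snd (ransac_loop x d A) =
      spmf_of_pmf (geometric1_pmf (success_prob (card R) d (card A) m 1))"
    using D by (intro ransac_loop_iterations[OF finite_A refl _ eq]) (auto simp: card_gt_0_iff)
qed

text \<open>One round preserves the invariant. By disjointness the other clusters lose no
  points.\<close>

lemma remove_cluster:
  assumes k: "k \<in> R"
  shows "subspace_clusters x L d m {i\<in>A. x i \<notin> L k} (R - {k})"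
    and "card {i\<in>A. x i \<notin> L k} = card A - m"
proof -
  have "{i\<in>A. x i \<notin> L k} = A - {i\<in>A. x i \<in> L k}"
    by auto
  then show "card {i\<in>A. x i \<notin> L k} = card A - m"
    using finite_A card_cluster[OF k] by (simp add: card_Diff_subset)
  show "subspace_clusters x L d m {i\<in>A. x i \<notin> L k} (R - {k})"
  proof
    fix l assume l: "l \<in> R - {k}"
    then have "{i \<in> {i\<in>A. x i \<notin> L k}. x i \<in> L l} = {i\<in>A. x i \<in> L l}"
      using disjoint k by auto
    then show "card {i \<in> {i\<in>A. x i \<notin> L k}. x i \<in> L l} = m"
      using l card_cluster by simp
  next
    fix S assume S: "S \<subseteq> {i\<in>A. x i \<notin> L k}" "card S \<le> d + 1"
    \<comment> \<open>No remaining point lies on \<open>L k\<close>, so the exceptional subspace for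
      \<open>S\<close> is never the removed one.\<close>
    then have "{i\<in>S. x i \<in> L k} = {}"
      by auto
    then have "\<not> d + 1 \<le> card {i\<in>S. x i \<in> L k}"
      by (metis Suc_eq_plus1 card.empty not_less_eq_eq zero_le)
    then show "(\<exists>l\<in>R - {k}. d + 1 \<le> card {i\<in>S. x i \<in> L l}) \<or> lin_indep_tuple x S"
      using general_position[of S] S by blast
  qed (use finite_A finite_R subspace dim m disjoint in auto)
qed

end

section \<open>The full algorithm\<close>

text \<open>Round \<open>Suc j\<close> of an instance is round \<open>j\<close> of the instance with
  one cluster removed. At \<open>j = 0\<close> the truncated \<open>j - 1\<close> would lose one
  multiple of \<open>m\<close>.\<close>

lemma success_prob_Suc:
  assumes "j \<ge> 1"
  shows "success_prob (Suc K) d n m (Suc j) = success_prob K d (n - m) m j"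
proof -
  have "n - j * m = n - m - (j - 1) * m"
    using assms by (cases j) auto
  then show ?thesis
    using assms by (simp add: success_prob_def)
qed

text \<open>Induction on the number of subspaces left, each step running one loop and passing to the
  reduced instance. A multiset records the output because the order of discovery is random.\<close>

lemma ransac_clusters:
  assumes "subspace_clusters x L d m A R" "card R = K"
  shows "\<forall>(Vs, t)\<in>set_spmf (ransac x d K A). mset Vs = image_mset L (mset_set R)"
    and "map_spmf snd (ransac x d K A) =
      spmf_of_pmf (indep_sum_pmf K (\<lambda>j. geometric1_pmf (success_prob K d (card A) m j)))"
    and "\<forall>j\<in>{1..K}. 0 < success_prob K d (card A) m j \<and> success_prob K d (card A) m j \<le> 1"
proof -
  let ?P = "\<lambda>K n j. geometric1_pmf (success_prob K d n m j)"
  have "(\<forall>(Vs, t)\<in>set_spmf (ransac x d K A). mset Vs = image_mset L (mset_set R)) \<and>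
      map_spmf snd (ransac x d K A) = spmf_of_pmf (indep_sum_pmf K (?P K (card A))) \<and>
      (\<forall>j\<in>{1..K}. 0 < success_prob K d (card A) m j \<and> success_prob K d (card A) m j \<le> 1)"
    using assms
  proof (induction K arbitrary: A R)
    case 0
    then interpret subspace_clusters x L d m A R by simp
    show ?case
      using 0 finite_R by (simp add: indep_sum_pmf_0)
  next
    case (Suc K)
    then interpret subspace_clusters x L d m A R by simp
    have R: "R \<noteq> {}"
      using Suc.prems by auto
    have IH: "(\<forall>(Vs, t)\<in>set_spmf (ransac x d K {i\<in>A. x i \<notin> L k}).
          mset Vs = image_mset L (mset_set (R - {k})))"
        "map_spmf snd (ransac x d K {i\<in>A. x i \<notin> L k}) =
          spmf_of_pmf (indep_sum_pmf K (?P K (card A - m)))"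
        "\<forall>j\<in>{1..K}. 0 < success_prob K d (card A - m) m j \<and> success_prob K d (card A - m) m j \<le> 1"
      if "k \<in> R" for k
      using Suc.IH[OF remove_cluster(1)[OF that]] remove_cluster(2)[OF that] Suc.prems(2) that
        finite_R by auto
    have "mset Vs = image_mset L (mset_set R)"
      if "(Vs, t) \<in> set_spmf (ransac x d (Suc K) A)" for Vs t
    proof -
      from that obtain V s Vs' t' where *: "(V, s) \<in> set_spmf (ransac_loop x d A)"
          "(Vs', t') \<in> set_spmf (ransac x d K {i\<in>A. x i \<notin> V})" "Vs = V # Vs'"
        by (auto simp: set_bind_spmf bind_UNION)
      obtain k where k: "k \<in> R" "V = L k"
        using ransac_loop_in_range[OF *(1)] by auto
      have "mset Vs' = image_mset L (mset_set (R - {k}))"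
        using IH(1)[OF k(1)] *(2) k by auto
      then show ?thesis
        using k *(3) finite_R by (simp add: mset_set.remove)
    qed
    moreover have "map_spmf snd (ransac x d (Suc K) A) =
        spmf_of_pmf (indep_sum_pmf (Suc K) (?P (Suc K) (card A)))"
    proof -
      let ?Q = "indep_sum_pmf K (?P K (card A - m))"
      have "map_spmf snd (ransac x d (Suc K) A) = bind_spmf (ransac_loop x d A)
          (\<lambda>(V, s). map_spmf ((+) s) (map_spmf snd (ransac x d K {i\<in>A. x i \<notin> V})))"
        by (simp add: map_spmf_conv_bind_spmf split_def)
      also have "\<dots> = bind_spmf (ransac_loop x d A)
          (\<lambda>(V, s). spmf_of_pmf (map_pmf ((+) s) ?Q))"
        using ransac_loop_in_range IH(2) by (intro bind_spmf_cong) fastforce+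
      also have "\<dots> = bind_spmf (map_spmf snd (ransac_loop x d A))
          (\<lambda>s. spmf_of_pmf (map_pmf ((+) s) ?Q))"
        by (simp add: bind_map_spmf o_def split_def)
      also have "\<dots> = spmf_of_pmf (bind_pmf (?P (Suc K) (card A) 1) (\<lambda>s. map_pmf ((+) s) ?Q))"
        using success_prob_first(3)[OF R] Suc.prems(2) by (simp add: spmf_of_pmf_bind)
      also have "?Q = indep_sum_pmf K (\<lambda>j. ?P (Suc K) (card A) (Suc j))"
        by (intro indep_sum_pmf_cong) (simp add: success_prob_Suc)
      finally show ?thesis
        by (simp only: indep_sum_pmf_Suc)
    qed
    moreover have "0 < success_prob (Suc K) d (card A) m j \<and> success_prob (Suc K) d (card A) m j \<le> 1"
      if j: "j \<in> {1..Suc K}" for j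
    proof (cases "j = 1")
      case True
      then show ?thesis
        using success_prob_first(1,2)[OF R] Suc.prems(2) by simp
    next
      case False
      then obtain i where "j = Suc i" "i \<in> {1..K}"
        using j by (cases j) (auto simp: Suc_le_eq)
      then show ?thesis
        using IH(3) R by (auto simp: success_prob_Suc)
    qed
    ultimately show ?case by blast
  qed
  then show "\<forall>(Vs, t)\<in>set_spmf (ransac x d K A). mset Vs = image_mset L (mset_set R)"
    and "map_spmf snd (ransac x d K A) = spmf_of_pmf (indep_sum_pmf K (?P K (card A)))"
    and "\<forall>j\<in>{1..K}. 0 < success_prob K d (card A) m j \<and> success_prob K d (card A) m j \<le> 1"
    by blast+
qed

section \<open>Comparison with \<open>theta1\<close> and the final bounds\<close>

text \<open>At least one subspace remains, so the numerator is no smaller; the points have only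
  become fewer, so the denominator is no larger.\<close>

lemma theta1_le_success_prob:
  assumes "j \<in> {1..K}" "0 < success_prob K d n m j"
  shows "theta1 d n m \<le> success_prob K d n m j"
proof -
  let ?b = "(n - (j - 1) * m) choose (d + 1)"
  \<comment> \<open>A zero denominator would make the quotient 0 by the convention for division,
    against the assumed positivity.\<close>
  have b: "0 < ?b"
  proof (rule ccontr)
    assume "\<not> 0 < ?b"
    then have "?b = 0"
      by simp
    then show False
      using assms(2) unfolding success_prob_def by (simp only: of_nat_0 div_by_0 less_irrefl)
  qed
  have "?b \<le> n choose (d + 1)"
    by (intro binomial_right_mono) auto
  moreover have "real (m choose (d + 1)) \<le> real (K - j + 1) * real (m choose (d + 1))"
    by (simp add: distrib_right)
  ultimately show ?thesis
    unfolding success_prob_def theta1_def using b by (intro frac_le) auto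
qed

lemma theta1_pos:
  assumes "d + 1 \<le> m" "m \<le> n"
  shows "0 < theta1 d n m"
  using assms by (simp add: theta1_def zero_less_binomial)

text \<open>Combines \<open>(m / q) ^ q\<close> as a lower bound for \<open>m choose q\<close> with
  \<open>n ^ q\<close> as an upper bound for \<open>n choose q\<close>, at
  \<open>q = d + 1\<close>.\<close>

lemma inverse_theta1_le:
  assumes "d + 1 \<le> m" "m \<le> n"
  shows "1 / theta1 d n m \<le> real (d + 1) ^ (d + 1) * (real n / real m) ^ (d + 1)"
proof -
  have m: "0 < m"
    using assms by simp
  have lower: "(real m / real (d + 1)) ^ (d + 1) \<le> real (m choose (d + 1))"
    using binomial_ge_n_over_k_pow_k[of "d + 1" m, where 'a = real] assms by simp
  have upper: "real (n choose (d + 1)) \<le> real n ^ (d + 1)"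
    using binomial_le_pow[of "d + 1" n] assms by (metis le_trans of_nat_le_iff of_nat_power)
  have "1 / theta1 d n m = real (n choose (d + 1)) / real (m choose (d + 1))"
    by (simp add: theta1_def)
  also have "\<dots> \<le> real n ^ (d + 1) / (real m / real (d + 1)) ^ (d + 1)"
    using lower upper m by (intro frac_le) auto
  also have "\<dots> = real (d + 1) ^ (d + 1) * (real n / real m) ^ (d + 1)"
    by (simp add: power_divide del: power_Suc of_nat_Suc)
  finally show ?thesis .
qed

theorem proposition3:
  fixes x :: "nat \<Rightarrow> real ^ 'p"
    and L :: "nat \<Rightarrow> (real ^ 'p) set"
    and n m d K :: nat
  assumes d: "1 \<le> d" "d < CARD('p)"
    and L: "\<forall>k\<in>{1..K}. subspace (L k) \<and> dim (L k) = d"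
    and m: "d + 1 \<le> m"
    and card_L: "\<forall>k\<in>{1..K}. card {i\<in>{1..n}. x i \<in> L k} = m"
    and disj: "\<forall>i\<in>{1..n}. \<forall>k\<in>{1..K}. \<forall>l\<in>{1..K}. x i \<in> L k \<and> x i \<in> L l \<longrightarrow> k = l"
    and general_position: "\<forall>q\<le>CARD('p). \<forall>S\<in>tuples q {1..n}.
          (\<exists>k\<in>{1..K}. d + 1 \<le> card {i\<in>S. x i \<in> L k}) \<or> lin_indep_tuple x S"
  shows "lossless_spmf (ransac x d K {1..n})
     \<and> (\<forall>(Vs, t)\<in>set_spmf (ransac x d K {1..n}). mset Vs = mset (map L [1..<K+1]))
     \<and> map_spmf snd (ransac x d K {1..n}) =
         spmf_of_pmf (indep_sum_pmf K (\<lambda>j. geometric1_pmf (success_prob K d n m j)))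
     \<and> stochastically_bounded
         (indep_sum_pmf K (\<lambda>j. geometric1_pmf (success_prob K d n m j)))
         (neg_binomial_trials_pmf K (theta1 d n m))
     \<and> integrable (measure_spmf (ransac x d K {1..n})) (\<lambda>(Vs, t). real t)
     \<and> (\<integral>(Vs, t). real t \<partial>measure_spmf (ransac x d K {1..n})) \<le> real K / theta1 d n m
     \<and> (\<exists>C. \<forall>n' m'. d + 1 \<le> m' \<and> m' \<le> n' \<longrightarrow>
          real K / theta1 d n' m' \<le> C * (real n' / real m') ^ (d + 1))"
proof (intro conjI)
  let ?r = "ransac x d K {1..n}"
  let ?p = "success_prob K d n m"
  let ?P = "\<lambda>j. geometric1_pmf (?p j)"
  have "subspace_clusters x L d m {1..n} {1..K}"
  proof
    fix S assume "S \<subseteq> {1..n}" "card S \<le> d + 1"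
    then show "(\<exists>k\<in>{1..K}. d + 1 \<le> card {i\<in>S. x i \<in> L k}) \<or> lin_indep_tuple x S"
      using general_position[rule_format, of "card S" S] d by (auto simp: tuples_def)
  next
    fix i k l assume "i \<in> {1..n}" "k \<in> {1..K}" "l \<in> {1..K}" "x i \<in> L k" "x i \<in> L l"
    then show "k = l"
      using disj by blast
  qed (use L m card_L in auto)
  note clusters = ransac_clusters[OF this, of K, simplified]
  show iterations: "map_spmf snd ?r = spmf_of_pmf (indep_sum_pmf K ?P)"
    using clusters(2) by simp
  \<comment> \<open>Mapping preserves total mass, and the image is a genuine
    \<open>pmf\<close>.\<close>
  then show "lossless_spmf ?r"
    by (metis lossless_map_spmf lossless_spmf_spmf_of_spmf)
  have "{1..K} = {1..<K + 1}"
    by auto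
  then have "image_mset L (mset_set {1..K}) = mset (map L [1..<K + 1])"
    by (simp only: mset_map mset_upt)
  then show "\<forall>(Vs, t)\<in>set_spmf ?r. mset Vs = mset (map L [1..<K+1])"
    using clusters(1) by simp
  \<comment> \<open>\<open>m \<le> n\<close> is read off from the cluster of \<open>L j\<close>,
    hence the restriction to actual indices; for \<open>K = 0\<close> all the sums below are
    empty.\<close>
  have p: "0 < ?p j" "?p j \<le> 1" "0 < theta1 d n m" "theta1 d n m \<le> ?p j" if "j \<in> {1..K}" for j
  proof -
    have "card {i\<in>{1..n}. x i \<in> L j} \<le> card {1..n}"
      by (intro card_mono) auto
    then have "m \<le> n"
      using card_L that by simp
    then show "0 < ?p j" "?p j \<le> 1" "0 < theta1 d n m" "theta1 d n m \<le> ?p j"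
      using clusters(3) that m by (auto intro!: theta1_pos theta1_le_success_prob)
  qed
  show "stochastically_bounded (indep_sum_pmf K ?P) (neg_binomial_trials_pmf K (theta1 d n m))"
    unfolding neg_binomial_trials_pmf_def indep_sum_pmf_eq
    using p by (intro stochastically_bounded_sum_pmf stochastically_bounded_geometric1) auto
  \<comment> \<open>Expressing the law of the count as a pushforward transfers integrability and
    expectation from the independent sum to the program.\<close>
  have law: "measure_pmf (indep_sum_pmf K ?P) = distr (measure_spmf ?r) (count_space UNIV) snd"
    using iterations by (metis measure_map_spmf_conv_distr measure_spmf_spmf_of_pmf)
  note expectation = sum_pmf_expectation[of "{1..K}" ?P, OF _ geometric1_expectation(1),
      folded indep_sum_pmf_eq, unfolded law]
  show "integrable (measure_spmf ?r) (\<lambda>(Vs, t). real t)"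
    using expectation(1) p by (simp add: integrable_distr_eq split_def)
  have "(\<integral>(Vs, t). real t \<partial>measure_spmf ?r) = (\<Sum>j=1..K. 1 / ?p j)"
    using expectation(2) p by (simp add: integral_distr split_def geometric1_expectation(2))
  also have "\<dots> \<le> (\<Sum>j=1..K. 1 / theta1 d n m)"
    using p by (intro sum_mono divide_left_mono mult_pos_pos) auto
  finally show "(\<integral>(Vs, t). real t \<partial>measure_spmf ?r) \<le> real K / theta1 d n m"
    by simp
  show "\<exists>C. \<forall>n' m'. d + 1 \<le> m' \<and> m' \<le> n' \<longrightarrow>
      real K / theta1 d n' m' \<le> C * (real n' / real m') ^ (d + 1)"
  \<comment> \<open>The witness is \<open>real K * real (d + 1) ^ (d + 1)\<close>, which depends on
    \<open>d\<close> and \<open>K\<close> only.\<close>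
  proof (intro exI allI impI)
    fix n' m' assume "d + 1 \<le> m' \<and> m' \<le> n'"
    then have "real K * (1 / theta1 d n' m') \<le>
        real K * (real (d + 1) ^ (d + 1) * (real n' / real m') ^ (d + 1))"
      using inverse_theta1_le by (intro mult_left_mono) auto
    then show "real K / theta1 d n' m' \<le>
        (real K * real (d + 1) ^ (d + 1)) * (real n' / real m') ^ (d + 1)"
      by (simp add: mult.assoc)
  qed
qed

end
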